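(* Let $Y\subset\mathbb{R}^n$, $X\subset\mathbb{R}^m$ be two nonempty compact convex sets. Let $f\in\mathcal{C}^1(Y\times X)$ be convex on $Y\times X$. Let $(\mathcal{Q}^k)_{k\ge1}$ be a sequence of convex $L$-Lipschitz continuous functions on $Y$ satisfying $\underline{\mathcal{Q}}\le\mathcal{Q}^k\le\bar{\mathcal{Q}}$ on $Y$, where $\underline{\mathcal{Q}},\bar{\mathcal{Q}}$ are continuous on $Y$. Let $g\in\mathcal{C}^1(Y\times X)$ with components $g_i$, $i=1,\ldots,p$, convex on $Y\times X^{\varepsilon}$ for some $\varepsilon>0$. Let $A,B$ be real $q\times n$ and $q\times m$ matrices and $b\in\mathbb{R}^q$. Assume that there exist $\kappa>0$ and $r>0$ such that for every $x\in X$ there is $y\in Y$ with $\mathbb{B}_n(y,r)\cap\mathrm{Aff}(Y)\subseteq Y$, $Ay+Bx=b$, and $g(y,x)<-\kappa\mathbf{e}$, where $\mathbf{e}$ is the vector of ones of size $p$. Let $(x^k)_{k\ge1}$ be a sequence in $X$, $(\varepsilon^k)_{k\ge1}$ a sequence of nonnegative real numbers, and let $y^k(\varepsilon^k)$ be an $\varepsilon^k$-optimal and feasible solution of $$\inf\{f(y,x^k)+\mathcal{Q}^k(y):y\in Y,\ Ay+Bx^k=b,\ g(y,x^k)\le0\}.$$ Let $(\lambda^k(\varepsilon^k),\mu^k(\varepsilon^k))$ be an $\varepsilon^k$-optimal solution of the dual problem $$\sup_{\lambda,\mu}\{h_{x^k}^k(\lambda,\mu):\lambda=Ay+Bx^k-b,\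 y\in\mathrm{Aff}(Y),\ \mu\ge0\},$$ where $$h_{x^k}^k(\lambda,\mu)=\inf_{y\in Y}\{f(y,x^k)+\mathcal{Q}^k(y)+\langle\lambda,Ay+Bx^k-b\rangle+\langle\mu,g(y,x^k)\rangle\}.$$ Define $\eta^k(\varepsilon^k)$ as the optimal value of $$\max_{y\in Y}\Big\langle\nabla_yf(y^k(\varepsilon^k),x^k)+A^T\lambda^k(\varepsilon^k)+\sum_{i=1}^p\mu^k(\varepsilon^k)(i)\nabla_yg_i(y^k(\varepsilon^k),x^k),\ y^k(\varepsilon^k)-y\Big\rangle+\mathcal{Q}^k(y^k(\varepsilon^k))-\mathcal{Q}^k(y).$$ Then if $\lim_{k\to+\infty}\varepsilon^k=0$ we have $\lim_{k\to+\infty}\eta^k(\varepsilon^k)=0$.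
   Context: $\mathcal{C}^1(Y\times X)$ is the set of continuously differentiable functions on $Y\times X$; $X^\varepsilon=X+\varepsilon\mathbb{B}_m(0,1)$; $\mathbb{B}_n(y,r)$ is the closed Euclidean ball; $\mathrm{Aff}(Y)$ is the affine span of $Y$. An $\varepsilon$-optimal solution is a feasible point whose objective value is within $\varepsilon$ of the optimal value. *)

theory Defs
  imports "HOL-Analysis.Analysis"
begin

text \<open>
  \<open>C1_gradient_on S f G\<close>: \<open>f\<close> is continuously differentiable on \<open>S\<close> and \<open>G\<close> is its gradient
  field. Differentiability is taken relative to \<open>S\<close>, so nothing is required of \<open>f\<close> off \<open>S\<close>.
  If \<open>f\<close> is continuously differentiable on a neighbourhood of \<open>S\<close>, its usual gradient is such
  a \<open>G\<close>. When \<open>S\<close> has empty interior the gradient relative to \<open>S\<close> need not be unique, which is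
  why \<open>G\<close> is an explicit argument.

  For \<open>S = Y \<times> X\<close>, the gradient is a pair: \<open>fst (G (y, x))\<close> is the partial gradient in \<open>y\<close>.
\<close>
definition C1_gradient_on :: "'a::euclidean_space set \<Rightarrow> ('a \<Rightarrow> real) \<Rightarrow> ('a \<Rightarrow> 'a) \<Rightarrow> bool" where
  "C1_gradient_on S f G \<longleftrightarrow>
     (\<forall>z\<in>S. (f has_derivative (\<lambda>h. G z \<bullet> h)) (at z within S)) \<and> continuous_on S G"

definition enlarge :: "'a::real_normed_vector set \<Rightarrow> real \<Rightarrow> 'a set" where
  "enlarge X e = {x + e *\<^sub>R u | x u. x \<in> X \<and> u \<in> cball 0 1}"

text \<open>
  Optimal values are \<open>Inf\<close> and \<open>Sup\<close> in the reals, hence meaningful only for nonempty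
  feasible sets and objectives bounded on them. This is the case below: \<open>Y\<close> is compact, all functions
  involved are continuous on \<open>Y\<close>, the Slater condition makes the primal problem feasible, and then
  weak duality bounds the dual function from above.
\<close>
definition eps_opt_min :: "('a \<Rightarrow> real) \<Rightarrow> 'a set \<Rightarrow> real \<Rightarrow> 'a \<Rightarrow> bool" where
  "eps_opt_min F S e z \<longleftrightarrow> z \<in> S \<and> \<bar>F z - (INF w\<in>S. F w)\<bar> \<le> e"

definition eps_opt_max :: "('a \<Rightarrow> real) \<Rightarrow> 'a set \<Rightarrow> real \<Rightarrow> 'a \<Rightarrow> bool" where
  "eps_opt_max F S e z \<longleftrightarrow> z \<in> S \<and> \<bar>F z - (SUP w\<in>S. F w)\<bar> \<le> e"

definition primal_feasible ::
  "(real^'n) set \<Rightarrow> real^'n^'q \<Rightarrow> real^'m^'q \<Rightarrow> real^'q \<Rightarrow> ((real^'n) \<times> (real^'m) \<Rightarrow> real^'p)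
     \<Rightarrow> real^'m \<Rightarrow> (real^'n) set" where
  "primal_feasible Y A B b g x = {y \<in> Y. A *v y + B *v x = b \<and> (\<forall>i. g (y, x) $ i \<le> 0)}"

definition dual_feasible ::
  "(real^'n) set \<Rightarrow> real^'n^'q \<Rightarrow> real^'m^'q \<Rightarrow> real^'q \<Rightarrow> real^'m \<Rightarrow> ((real^'q) \<times> (real^'p)) set" where
  "dual_feasible Y A B b x =
     {(l, m). (\<exists>y \<in> affine hull Y. l = A *v y + B *v x - b) \<and> (\<forall>i. 0 \<le> m $ i)}"

definition dual_fun ::
  "(real^'n) set \<Rightarrow> real^'n^'q \<Rightarrow> real^'m^'q \<Rightarrow> real^'q \<Rightarrow> ((real^'n) \<times> (real^'m) \<Rightarrow> real^'p)
     \<Rightarrow> ((real^'n) \<times> (real^'m) \<Rightarrow> real) \<Rightarrow> (real^'n \<Rightarrow> real) \<Rightarrow> real^'m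
     \<Rightarrow> (real^'q) \<times> (real^'p) \<Rightarrow> real" where
  "dual_fun Y A B b g f Q x = (\<lambda>(l, m).
     INF y\<in>Y. f (y, x) + Q y + l \<bullet> (A *v y + B *v x - b) + m \<bullet> g (y, x))"

text \<open>\<open>Gf\<close> and \<open>Gg i\<close> stand for the gradients of \<open>f\<close> and of the component \<open>g\<^sub>i\<close>.\<close>
definition eta ::
  "(real^'n) set \<Rightarrow> real^'n^'q \<Rightarrow> ((real^'n) \<times> (real^'m) \<Rightarrow> (real^'n) \<times> (real^'m))
     \<Rightarrow> ('p::finite \<Rightarrow> (real^'n) \<times> (real^'m) \<Rightarrow> (real^'n) \<times> (real^'m))
     \<Rightarrow> (real^'n \<Rightarrow> real) \<Rightarrow> real^'m \<Rightarrow> real^'n \<Rightarrow> real^'q \<Rightarrow> real^'p \<Rightarrow> real" where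
  "eta Y A Gf Gg Q x yk l m =
     (SUP y\<in>Y. (fst (Gf (yk, x)) + transpose A *v l + (\<Sum>i\<in>UNIV. m $ i *\<^sub>R fst (Gg i (yk, x))))
                  \<bullet> (yk - y) + Q yk - Q y)"

end

theory Submission
  imports Defs
begin

text \<open>
  Write \<open>S\<^sub>k(y) = f(y, x\<^sup>k) + \<langle>\<lambda>\<^sup>k, A y + B x\<^sup>k - b\<rangle> + \<langle>\<mu>\<^sup>k, g(y, x\<^sup>k)\<rangle>\<close>, so that \<open>S\<^sub>k + Q\<^sup>k\<close> is the
  Lagrangian at the given multipliers, and \<open>\<eta>\<^sup>k\<close> is the largest decrease over \<open>Y\<close> of the model
  obtained by linearising \<open>S\<^sub>k\<close> at \<open>y\<^sup>k\<close> and keeping \<open>Q\<^sup>k\<close>. It is nonnegative, as \<open>y = y\<^sup>k\<close>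
  gives no decrease. Two facts make it small.

  First, \<open>y\<^sup>k\<close> minimises \<open>S\<^sub>k + Q\<^sup>k\<close> over \<open>Y\<close> up to \<open>2 \<epsilon>\<^sup>k\<close>. The Slater condition gives strong duality
  (lemma \<open>slater_multipliers\<close>), so the dual function at \<open>(\<lambda>\<^sup>k, \<mu>\<^sup>k)\<close>, which is the minimum of
  \<open>S\<^sub>k + Q\<^sup>k\<close>, is within \<open>\<epsilon>\<^sup>k\<close> of the primal optimal value; that value is within \<open>\<epsilon>\<^sup>k\<close> of the objective
  at \<open>y\<^sup>k\<close>, which in turn is at least \<open>S\<^sub>k(y\<^sup>k) + Q\<^sup>k(y\<^sup>k)\<close> by feasibility. This is lemma
  \<open>lagrangian_eps_optimality\<close>.

  Second, moving from \<open>y\<^sup>k\<close> a fraction \<open>t\<close> of the way to some \<open>z \<in> Y\<close> changes \<open>S\<^sub>k + Q\<^sup>k\<close> by at most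
  \<open>t\<close> times the change predicted by the model at \<open>z\<close>, plus the length \<open>t \<parallel>z - y\<^sup>k\<parallel>\<close> of the step times the
  variation of \<open>\<nabla>S\<^sub>k\<close> over it. As the change is at least \<open>-2 \<epsilon>\<^sup>k\<close>, the model decrease is at most
  \<open>2 \<epsilon>\<^sup>k / t\<close> plus \<open>\<parallel>z - y\<^sup>k\<parallel>\<close> times that variation (lemma \<open>linearised_gap_le\<close>).
  The variation is small with \<open>t\<close>, uniformly in \<open>k\<close>: the gradients of \<open>f\<close> and \<open>g\<^sub>i\<close> are uniformly continuous on the compact set \<open>Y \<times> X\<close>, the term in \<open>\<lambda>\<^sup>k\<close> has a constant
  gradient and so cancels, and \<open>\<mu>\<^sup>k\<close> is bounded, because comparing \<open>y\<^sup>k\<close> with a Slater point, where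
  \<open>\<langle>\<mu>\<^sup>k, g\<rangle>\<close> is at most \<open>-\<kappa>\<close> times the sum of the entries of \<open>\<mu>\<^sup>k\<close>, bounds this sum. So one fixes \<open>t\<close> first
  and then lets \<open>\<epsilon>\<^sup>k\<close> tend to \<open>0\<close>.
\<close>

section \<open>Lagrange multipliers under a Slater condition\<close>

text \<open>
  The set consists of the perturbations \<open>(u, w)\<close> of the constraints \<open>A y = c\<close> and \<open>G y \<le> 0\<close>
  together with the objective levels reachable under them. Multipliers are the normals of hyperplanes
  supporting it, which is why its convexity matters.
\<close>
lemma convex_perturbation_set:
  fixes F :: "'a::real_vector \<Rightarrow> real" and G :: "'a \<Rightarrow> real^'p" and A :: "'a \<Rightarrow> 'b::real_vector"
  assumes F: "convex_on Y F" and G: "\<And>i. convex_on Y (\<lambda>y. G y $ i)" and A: "linear A"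
  shows "convex {(A y - c, w, s) | y w s. y \<in> Y \<and> (\<forall>i. G y $ i \<le> w $ i) \<and> F y \<le> s}"
proof (rule convexI)
  interpret linear A by fact
  fix p q :: "'b \<times> (real^'p) \<times> real" and u v :: real
  assume "p \<in> {(A y - c, w, s) | y w s. y \<in> Y \<and> (\<forall>i. G y $ i \<le> w $ i) \<and> F y \<le> s}"
    and "q \<in> {(A y - c, w, s) | y w s. y \<in> Y \<and> (\<forall>i. G y $ i \<le> w $ i) \<and> F y \<le> s}"
    and uv: "u \<ge> 0" "v \<ge> 0" "u + v = 1"
  then obtain y w s y' w' s' where p: "p = (A y - c, w, s)" "y \<in> Y" "\<forall>i. G y $ i \<le> w $ i" "F y \<le> s"
    and q: "q = (A y' - c, w', s')" "y' \<in> Y" "\<forall>i. G y' $ i \<le> w' $ i" "F y' \<le> s'"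
    by blast
  let ?y = "u *\<^sub>R y + v *\<^sub>R y'"
  have "?y \<in> Y"
    using F p q uv by (auto simp: convex_on_def convex_def)
  moreover have "F ?y \<le> u * s + v * s'"
  proof -
    have "F ?y \<le> u * F y + v * F y'" using F p q uv by (auto simp: convex_on_def)
    also have "\<dots> \<le> u * s + v * s'" using p q uv by (intro add_mono mult_left_mono)
    finally show ?thesis .
  qed
  moreover have "G ?y $ i \<le> (u *\<^sub>R w + v *\<^sub>R w') $ i" for i
  proof -
    have "G ?y $ i \<le> u * G y $ i + v * G y' $ i" using G[of i] p q uv by (auto simp: convex_on_def)
    also have "\<dots> \<le> u * w $ i + v * w' $ i" using p q uv by (intro add_mono mult_left_mono) auto
    finally show ?thesis by simp
  qed
  moreover have "u *\<^sub>R (A y - c) + v *\<^sub>R (A y' - c) = A ?y - c"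
  proof -
    have "u *\<^sub>R c + v *\<^sub>R c = c" using uv by (metis scaleR_left_distrib scaleR_one)
    then show ?thesis by (simp add: add scale algebra_simps)
  qed
  ultimately show "u *\<^sub>R p + v *\<^sub>R q \<in> {(A y - c, w, s) | y w s. y \<in> Y \<and> (\<forall>i. G y $ i \<le> w $ i) \<and> F y \<le> s}"
    using p q by auto
qed

text \<open>
  From \<open>y\<close>, the segment through the relative interior point \<open>y0\<close> can be continued a little
  beyond \<open>y0\<close> inside \<open>Y\<close>; there the functional has the sign opposite to its sign at \<open>y\<close>.
\<close>
lemma linear_nonneg_vanishing_at_rel_interior:
  fixes Y :: "'a::euclidean_space set"
  assumes "convex Y" "y0 \<in> rel_interior Y" "linear A" "A y0 = c" "y \<in> Y"
    and nonneg: "\<And>y. y \<in> Y \<Longrightarrow> 0 \<le> l \<bullet> (A y - c)"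
  shows "l \<bullet> (A y - c) = 0"
proof -
  interpret linear A by fact
  obtain e where e: "e > 1" "(1 - e) *\<^sub>R y + e *\<^sub>R y0 \<in> Y"
    using convex_rel_interior_if2[OF assms(1,2)] \<open>y \<in> Y\<close> hull_inc by metis
  have "A ((1 - e) *\<^sub>R y + e *\<^sub>R y0) - c = (1 - e) *\<^sub>R (A y - c)"
    unfolding add scale assms(4) by (simp add: algebra_simps)
  then have "0 \<le> (1 - e) * (l \<bullet> (A y - c))"
    using nonneg[OF e(2)] by simp
  then show ?thesis
    using e(1) nonneg[OF \<open>y \<in> Y\<close>] by (auto simp: zero_le_mult_iff)
qed

text \<open>
  Since \<open>c\<close> is the image of a point of \<open>Y\<close>, the set \<open>(\<lambda>y. A y - c) ` (affine hull Y)\<close> is a linear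
  subspace. The component of a multiplier orthogonal to it is never seen by the constraints, so dual
  problems may restrict the multiplier of the equality constraint to this subspace.
\<close>
lemma multiplier_projection:
  fixes Y :: "'a::euclidean_space set" and A :: "'a \<Rightarrow> 'b::euclidean_space"
  assumes "y0 \<in> Y" "linear A" "A y0 = c"
  obtains l' where "l' \<in> (\<lambda>y. A y - c) ` (affine hull Y)" "\<And>y. y \<in> Y \<Longrightarrow> l' \<bullet> (A y - c) = l \<bullet> (A y - c)"
proof -
  let ?W = "(\<lambda>u. u - c) ` (A ` (affine hull Y))"
  have "affine (A ` (affine hull Y))"
    using assms(2) affine_affine_hull affine_hull_linear_image linear_conv_bounded_linear by metis
  then have W: "subspace ?W"
    using assms by (intro affine_diffs_subspace_subtract) (auto intro: hull_inc)
  obtain l1 l2 where l: "l1 \<in> span ?W" "\<And>w. w \<in> span ?W \<Longrightarrow> orthogonal l2 w" "l = l1 + l2"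
    using orthogonal_subspace_decomp_exists[of ?W l] by metis
  have sp: "span ?W = ?W" using W by (simp only: span_eq_iff)
  show ?thesis
  proof (rule that[of l1])
    show "l1 \<in> (\<lambda>y. A y - c) ` (affine hull Y)" using l(1) sp by auto
    fix y assume "y \<in> Y"
    then have "A y - c \<in> ?W" by (auto intro: hull_inc)
    then have "l2 \<bullet> (A y - c) = 0" using l(2) sp unfolding orthogonal_def by blast
    then show "l1 \<bullet> (A y - c) = l \<bullet> (A y - c)" using l(3) by (simp add: inner_add_left)
  qed
qed

text \<open>
  A hyperplane supports the perturbation set at \<open>(0, 0, F z)\<close>, and its normal, divided by the
  component along the objective, gives the multipliers. The Slater point excludes a vertical
  hyperplane. As \<open>A\<close> need not be surjective and \<open>Y\<close> may have empty interior, the perturbation set can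
  have empty interior too; a nonzero normal could then be orthogonal to the whole set. So the argument
  needs the proper form of the supporting hyperplane theorem, strict on the relative interior.
\<close>
lemma slater_multipliers:
  fixes F :: "'a::euclidean_space \<Rightarrow> real" and G :: "'a \<Rightarrow> real^'p" and A :: "'a \<Rightarrow> 'b::euclidean_space"
  assumes F: "convex_on Y F" and G: "\<And>i. convex_on Y (\<lambda>y. G y $ i)" and A: "linear A"
    and y0: "y0 \<in> rel_interior Y" "A y0 = c" "\<And>i. G y0 $ i < 0"
    and z: "z \<in> Y" "A z = c" "\<And>i. G z $ i \<le> 0"
    and opt: "\<And>y. y \<in> Y \<Longrightarrow> A y = c \<Longrightarrow> (\<And>i. G y $ i \<le> 0) \<Longrightarrow> F z \<le> F y"
  obtains l m where "l \<in> (\<lambda>y. A y - c) ` (affine hull Y)" "\<And>i. 0 \<le> m $ i"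
    "\<And>y. y \<in> Y \<Longrightarrow> F z \<le> F y + l \<bullet> (A y - c) + m \<bullet> G y"
proof -
  define C where "C = {(A y - c, w, s) | y w s. y \<in> Y \<and> (\<forall>i. G y $ i \<le> w $ i) \<and> F y \<le> s}"
  have C: "convex C" unfolding C_def by (rule convex_perturbation_set[OF F G A])
  have CI: "(A y - c, w, s) \<in> C" if "y \<in> Y" "\<And>i. G y $ i \<le> w $ i" "F y \<le> s" for y w s
    using that unfolding C_def by blast
  have Y: "convex Y" using F by (rule convex_on_imp_convex)
  have y0Y: "y0 \<in> Y" using y0(1) rel_interior_subset by blast
  have zC: "(0, 0, s) \<in> C" if "F z \<le> s" for s
    using CI[of z 0 s] z that by simp
  \<comment> \<open>Otherwise the vertical segment from \<open>(0, 0, F z + 1)\<close> could be prolonged below \<open>(0, 0, F z)\<close>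
    inside \<open>C\<close>, to a feasible point better than \<open>z\<close>.\<close>
  have "(0, 0, F z) \<notin> rel_interior C"
  proof
    assume "(0, 0, F z) \<in> rel_interior C"
    then obtain e where e: "e > 1" "(1 - e) *\<^sub>R (0, 0, F z + 1) + e *\<^sub>R (0, 0, F z) \<in> C"
      using convex_rel_interior_if2[OF C] zC[of "F z + 1"] hull_inc
      by (metis add.commute le_add_same_cancel2 zero_le_one)
    then obtain y where "y \<in> Y" "A y = c" "\<forall>i. G y $ i \<le> 0" "F y \<le> (1 - e) * (F z + 1) + e * F z"
      unfolding C_def by (auto simp: zero_prod_def)
    then show False using opt[of y] e(1) by (simp add: algebra_simps)
  qed
  then obtain a where "\<And>p. p \<in> C \<Longrightarrow> a \<bullet> (0, 0, F z) \<le> a \<bullet> p"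
      "\<And>p. p \<in> rel_interior C \<Longrightarrow> a \<bullet> (0, 0, F z) < a \<bullet> p"
    using supporting_hyperplane_rel_boundary[OF C zC[OF order_refl]] by metis
  moreover obtain l m s where "a = (l, m, s)" by (cases a)
  ultimately have le: "\<And>u w t. (u, w, t) \<in> C \<Longrightarrow> s * F z \<le> l \<bullet> u + m \<bullet> w + s * t"
    and less: "\<And>u w t. (u, w, t) \<in> rel_interior C \<Longrightarrow> s * F z < l \<bullet> u + m \<bullet> w + s * t"
    by (force simp: inner_Pair)+
  \<comment> \<open>\<open>C\<close> is closed under increasing \<open>w\<close> and \<open>t\<close>, which fixes the signs of \<open>s\<close> and \<open>m\<close>.\<close>
  have s0: "s \<ge> 0" using le[OF zC[of "F z + 1"]] by (simp add: algebra_simps)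
  have m0: "m $ i \<ge> 0" for i
  proof -
    have "(A z - c, axis i 1, F z) \<in> C" using z(1) order_trans[OF z(3)] by (intro CI) (auto simp: axis_def z(3))
    from le[OF this] show ?thesis using z(2) by (simp add: inner_axis)
  qed
  have "s > 0"
  proof (rule ccontr)
    assume "\<not> s > 0"
    then have s: "s = 0" using s0 by simp
    \<comment> \<open>The strict inequalities at \<open>y0\<close> force \<open>m = 0\<close>; then the functional vanishes on all of \<open>C\<close>,
      against strictness on the relative interior.\<close>
    have "0 \<le> m \<bullet> G y0" using le[OF CI[OF y0Y order_refl order_refl]] y0(2) s by simp
    moreover have "m \<bullet> G y0 = (\<Sum>i\<in>UNIV. m $ i * G y0 $ i)" by (simp add: inner_vec_def)
    moreover have nonpos: "m $ i * G y0 $ i \<le> 0" for i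
      using m0[of i] y0(3)[of i] by (simp add: mult_nonneg_nonpos)
    ultimately have "(\<Sum>i\<in>UNIV. - (m $ i * G y0 $ i)) = 0"
      using sum_nonpos[of UNIV "\<lambda>i. m $ i * G y0 $ i"] by (simp add: sum_negf)
    then have "\<forall>i. m $ i * G y0 $ i = 0"
      using nonpos by (subst (asm) sum_nonneg_eq_0_iff) auto
    then have m: "m = 0" using y0(3) by (auto simp: vec_eq_iff less_irrefl) (metis less_irrefl)
    have "0 \<le> l \<bullet> (A y - c)" if "y \<in> Y" for y
      using le[OF CI[OF that order_refl order_refl]] s m by simp
    then have l: "l \<bullet> (A y - c) = 0" if "y \<in> Y" for y
      using linear_nonneg_vanishing_at_rel_interior[OF Y y0(1) A y0(2) that] by blast
    have "rel_interior C \<noteq> {}" using zC[OF order_refl] C rel_interior_eq_empty by auto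
    then obtain u w t where uwt: "(u, w, t) \<in> rel_interior C" by auto
    then have "(u, w, t) \<in> C" using rel_interior_subset by blast
    then have "l \<bullet> u = 0" unfolding C_def using l by auto
    then show False using less[OF uwt] s m by simp
  qed
  obtain l' where l': "l' \<in> (\<lambda>y. A y - c) ` (affine hull Y)"
    "\<And>y. y \<in> Y \<Longrightarrow> l' \<bullet> (A y - c) = (l /\<^sub>R s) \<bullet> (A y - c)"
    using multiplier_projection[OF y0Y A y0(2)] by blast
  show ?thesis
  proof (rule that[OF l'(1)])
    show "0 \<le> (m /\<^sub>R s) $ i" for i using m0 \<open>s > 0\<close> by simp
    fix y assume y: "y \<in> Y"
    have "s * F z \<le> l \<bullet> (A y - c) + m \<bullet> G y + s * F y"
      by (rule le[OF CI[OF y order_refl order_refl]])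
    then have "F z \<le> (l \<bullet> (A y - c) + m \<bullet> G y + s * F y) / s"
      using \<open>s > 0\<close> by (simp add: pos_le_divide_eq mult.commute)
    also have "\<dots> = F y + l' \<bullet> (A y - c) + (m /\<^sub>R s) \<bullet> G y"
      unfolding l'(2)[OF y] using \<open>s > 0\<close> by (simp add: field_simps)
    finally show "F z \<le> F y + l' \<bullet> (A y - c) + (m /\<^sub>R s) \<bullet> G y" .
  qed
qed

section \<open>Approximate solutions minimise the Lagrangian approximately\<close>

text \<open>
  The left-hand side is the objective at \<open>yk\<close> rather than the Lagrangian. This stronger form serves
  two purposes: with \<open>m \<bullet> g (yk, x) \<le> 0\<close> it gives near-minimality of \<open>yk\<close> for the Lagrangian, and
  with \<open>w\<close> a Slater point it bounds \<open>m\<close>.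
\<close>
lemma lagrangian_eps_optimality:
  fixes Y :: "(real^'n) set" and f :: "(real^'n) \<times> (real^'m) \<Rightarrow> real" and Q :: "real^'n \<Rightarrow> real"
    and g :: "(real^'n) \<times> (real^'m) \<Rightarrow> real^'p"
    and A :: "real^'n^'q" and B :: "real^'m^'q" and b :: "real^'q"
  assumes Y: "compact Y"
    and F: "convex_on Y (\<lambda>y. f (y, x) + Q y)" "continuous_on Y (\<lambda>y. f (y, x) + Q y)"
    and G: "\<And>i. convex_on Y (\<lambda>y. g (y, x) $ i)" "continuous_on Y (\<lambda>y. g (y, x))"
    and y0: "y0 \<in> rel_interior Y" "A *v y0 + B *v x = b" "\<And>i. g (y0, x) $ i < 0"
    and primal: "eps_opt_min (\<lambda>y. f (y, x) + Q y) (primal_feasible Y A B b g x) e yk"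
    and dual: "eps_opt_max (dual_fun Y A B b g f Q x) (dual_feasible Y A B b x) e (l, m)"
    and w: "w \<in> Y"
  shows "f (yk, x) + Q yk \<le> f (w, x) + Q w + l \<bullet> (A *v w + B *v x - b) + m \<bullet> g (w, x) + 2 * e"
proof -
  let ?F = "\<lambda>y. f (y, x) + Q y"
  let ?P = "primal_feasible Y A B b g x"
  let ?D = "dual_feasible Y A B b x :: ((real^'q) \<times> (real^'p)) set"
  let ?h = "dual_fun Y A B b g f Q x"
  let ?L = "\<lambda>l m y. f (y, x) + Q y + l \<bullet> (A *v y + B *v x - b) + m \<bullet> g (y, x)"
  have y0Y: "y0 \<in> Y" using y0(1) rel_interior_subset by blast
  have h: "?h (l, m) = (INF y\<in>Y. ?L l m y)" for l m by (simp add: dual_fun_def)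
  have "continuous_on Y (?L l m)" for l m
    by (intro continuous_on_add F(2) G(2) continuous_on_inner continuous_on_const continuous_on_diff
        matrix_vector_mult_linear_continuous_on)
  then have bdd: "bdd_below (?L l m ` Y)" for l m
    using Y by (intro bounded_imp_bdd_below compact_imp_bounded compact_continuous_image)
  have hle: "?h (l, m) \<le> ?L l m y" if "y \<in> Y" for l m y
    unfolding h using bdd that by (rule cINF_lower)
  let ?con = "\<lambda>y. (A *v y + B *v x, g (y, x))"
  have P: "?P = Y \<inter> (Y \<inter> ?con -` ({b} \<times> {v. \<forall>i. v $ i \<le> 0}))"
    by (auto simp: primal_feasible_def)
  have "closed {v :: real^'p. \<forall>i. v $ i \<le> 0}"
    by (intro closed_Collect_all closed_Collect_le continuous_intros)
  moreover have "continuous_on Y ?con"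
    by (intro continuous_on_Pair G(2) continuous_on_add continuous_on_const
        matrix_vector_mult_linear_continuous_on)
  ultimately have "closed (Y \<inter> ?con -` ({b} \<times> {v. \<forall>i. v $ i \<le> 0}))"
    using compact_imp_closed[OF Y]
    by (intro continuous_closed_preimage closed_Times closed_singleton)
  then have "compact ?P" unfolding P using Y by (intro compact_Int_closed)
  moreover have "?P \<noteq> {}" using y0 y0Y less_imp_le by (auto simp: primal_feasible_def)
  moreover have "continuous_on ?P ?F"
    using F(2) by (rule continuous_on_subset) (auto simp: primal_feasible_def)
  ultimately obtain z where z: "z \<in> ?P" "\<And>y. y \<in> ?P \<Longrightarrow> ?F z \<le> ?F y"
    using continuous_attains_inf[of ?P ?F] by blast
  have "(INF y\<in>?P. ?F y) = ?F z" using z by (intro cInf_eq_minimum) auto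
  then have yk: "?F yk \<le> ?F z + e" using primal by (auto simp: eps_opt_min_def)

  have A: "A *v y = b - B *v x \<longleftrightarrow> A *v y + B *v x = b" for y
    by (auto simp: algebra_simps)
  obtain l' m' where lm': "l' \<in> (\<lambda>y. A *v y - (b - B *v x)) ` (affine hull Y)" "\<And>i. 0 \<le> m' $ i"
    "\<And>y. y \<in> Y \<Longrightarrow> ?F z \<le> ?F y + l' \<bullet> (A *v y - (b - B *v x)) + m' \<bullet> g (y, x)"
    by (rule slater_multipliers[OF F(1) G(1) matrix_vector_mul_linear[of A] y0(1), of "b - B *v x" z])
      (use y0 z in \<open>auto simp: A primal_feasible_def\<close>)
  have "(l', m') \<in> ?D" using lm'(1,2) by (auto simp: dual_feasible_def algebra_simps)
  moreover have "?F z \<le> ?h (l', m')"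
    unfolding h using y0Y lm'(3) by (intro cINF_greatest) (auto simp: algebra_simps)
  \<comment> \<open>Weak duality at the Slater point; it makes the supremum a genuine upper bound.\<close>
  moreover have "bdd_above (?h ` ?D)"
  proof (rule bdd_aboveI2)
    fix p assume p: "p \<in> ?D"
    obtain l m where lm: "p = (l, m)" by (cases p)
    have "m \<bullet> g (y0, x) \<le> 0" unfolding inner_vec_def using p lm y0(3)
      by (intro sum_nonpos) (auto simp: dual_feasible_def intro!: mult_nonneg_nonpos[OF _ less_imp_le])
    then show "?h p \<le> ?F y0" using hle[OF y0Y, of l m] y0(2) lm by simp
  qed
  ultimately have "?F z \<le> (SUP p\<in>?D. ?h p)" by (meson cSUP_upper order_trans)
  moreover have "(SUP p\<in>?D. ?h p) \<le> ?h (l, m) + e" using dual by (auto simp: eps_opt_max_def)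
  ultimately show ?thesis using yk hle[OF w, of l m] by linarith
qed

section \<open>From approximate minimality to a small linearised gap\<close>

text \<open>
  Compare \<open>y\<close> with \<open>y + t (z - y)\<close>: along this step \<open>Q\<close> is bounded by convexity and \<open>S\<close> by the
  mean value theorem. A first-order condition alone would need \<open>d = 0\<close>; with \<open>d > 0\<close> the step length \<open>t\<close>
  trades the error \<open>d / t\<close> against the variation \<open>\<omega>\<close> of the gradient.
\<close>
lemma linearised_gap_le:
  fixes S Q :: "'a::euclidean_space \<Rightarrow> real"
  assumes Q: "convex_on Y Q"
    and S: "\<And>w. w \<in> Y \<Longrightarrow> (S has_derivative (\<lambda>h. DS w \<bullet> h)) (at w within Y)"
    and yz: "y \<in> Y" "z \<in> Y" and t: "0 < t" "t \<le> 1"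
    and opt: "\<And>w. w \<in> Y \<Longrightarrow> S y + Q y \<le> S w + Q w + d"
    and near: "\<And>w. w \<in> Y \<Longrightarrow> norm (w - y) \<le> t * norm (z - y) \<Longrightarrow> norm (DS w - DS y) \<le> \<omega>"
  shows "DS y \<bullet> (y - z) + Q y - Q z \<le> d / t + \<omega> * norm (z - y)"
proof -
  let ?p = "\<lambda>s. y + s *\<^sub>R (z - y)"
  have Y: "convex Y" using Q by (rule convex_on_imp_convex)
  have p: "?p s \<in> Y" if "s \<in> {0..t}" for s
  proof -
    have "?p s = (1 - s) *\<^sub>R y + s *\<^sub>R z" by (simp add: algebra_simps)
    then show ?thesis using convexD_alt[OF Y yz, of s] that t by auto
  qed
  have "\<exists>s\<in>{0..t}. S (?p t) - S (?p 0) = DS (?p s) \<bullet> ((t - 0) *\<^sub>R (z - y))"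
  proof (rule mvt_very_simple)
    show "0 \<le> t" using t by simp
    fix s assume "0 \<le> s" "s \<le> t"
    then have s: "s \<in> {0..t}" by simp
    have "(?p has_derivative (\<lambda>h. h *\<^sub>R (z - y))) (at s within {0..t})"
      by (auto intro!: derivative_eq_intros)
    moreover have "(S has_derivative (\<lambda>h. DS (?p s) \<bullet> h)) (at (?p s) within ?p ` {0..t})"
      using S[OF p[OF s]] by (rule has_derivative_subset) (use p in blast)
    ultimately show "((\<lambda>s. S (?p s)) has_derivative (\<lambda>h. DS (?p s) \<bullet> (h *\<^sub>R (z - y)))) (at s within {0..t})"
      using has_derivative_in_compose by blast
  qed
  then obtain s where s: "s \<in> {0..t}" "S (?p t) - S y = t * (DS (?p s) \<bullet> (z - y))" by auto
  have "norm (DS (?p s) - DS y) \<le> \<omega>"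
    using s(1) by (intro near p) (auto intro!: mult_right_mono)
  then have "(DS (?p s) - DS y) \<bullet> (z - y) \<le> \<omega> * norm (z - y)"
    by (meson norm_cauchy_schwarz order_trans mult_right_mono norm_ge_zero)
  then have "S (?p t) - S y \<le> t * (DS y \<bullet> (z - y) + \<omega> * norm (z - y))"
    unfolding s(2) using t by (intro mult_left_mono) (auto simp: inner_diff_left)
  moreover have "Q (?p t) - Q y \<le> t * (Q z - Q y)"
  proof -
    have "?p t = (1 - t) *\<^sub>R y + t *\<^sub>R z" by (simp add: algebra_simps)
    then show ?thesis using convex_onD[OF Q, of t y z] t yz by (simp add: algebra_simps)
  qed
  moreover have "S y + Q y \<le> S (?p t) + Q (?p t) + d" using opt p[of t] t by simp
  ultimately have "t * (DS y \<bullet> (y - z) + Q y - Q z - \<omega> * norm (z - y)) \<le> d"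
    by (simp add: algebra_simps inner_diff_right)
  then have "DS y \<bullet> (y - z) + Q y - Q z - \<omega> * norm (z - y) \<le> d / t"
    using t by (simp add: pos_le_divide_eq mult.commute)
  then show ?thesis by simp
qed

section \<open>Partial functions of continuously differentiable and convex functions\<close>

lemma C1_gradient_on_continuous:
  assumes "C1_gradient_on S f G" shows "continuous_on S f"
  using assms unfolding C1_gradient_on_def by (intro has_derivative_continuous_on) auto

lemma C1_gradient_on_partial:
  fixes f :: "'a::euclidean_space \<times> 'b::euclidean_space \<Rightarrow> real"
  assumes f: "C1_gradient_on (Y \<times> X) f G" and x: "x \<in> X" "y \<in> Y"
  shows "((\<lambda>y. f (y, x)) has_derivative (\<lambda>h. fst (G (y, x)) \<bullet> h)) (at y within Y)"
proof -
  have "((\<lambda>y. (y, x)) has_derivative (\<lambda>h. (h, 0))) (at y within Y)"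
    by (auto intro!: derivative_eq_intros)
  moreover have "(f has_derivative (\<lambda>h. G (y, x) \<bullet> h)) (at (y, x) within (\<lambda>y. (y, x)) ` Y)"
    by (rule has_derivative_subset[of _ _ _ "Y \<times> X"]) (use f x in \<open>auto simp: C1_gradient_on_def\<close>)
  ultimately have "((\<lambda>y. f (y, x)) has_derivative (\<lambda>h. G (y, x) \<bullet> (h, 0))) (at y within Y)"
    using has_derivative_in_compose by blast
  then show ?thesis by (simp add: inner_prod_def)
qed

lemma C1_gradient_on_partial_modulus:
  fixes f :: "'a::euclidean_space \<times> 'b::euclidean_space \<Rightarrow> real"
  assumes f: "C1_gradient_on (Y \<times> X) f G" and "compact Y" "compact X" "\<omega> > 0"
  shows "\<exists>d>0. \<forall>y\<in>Y. \<forall>w\<in>Y. \<forall>x\<in>X. norm (w - y) < d \<longrightarrow> norm (fst (G (w, x)) - fst (G (y, x))) \<le> \<omega>"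
proof -
  have "uniformly_continuous_on (Y \<times> X) G"
    using assms by (intro compact_uniformly_continuous compact_Times) (auto simp: C1_gradient_on_def)
  then obtain d where d: "d > 0"
    "\<And>p q. p \<in> Y \<times> X \<Longrightarrow> q \<in> Y \<times> X \<Longrightarrow> dist q p < d \<Longrightarrow> dist (G q) (G p) < \<omega>"
    using \<open>\<omega> > 0\<close> unfolding uniformly_continuous_on_def by metis
  show ?thesis
  proof (intro exI conjI ballI impI)
    fix y w x assume *: "y \<in> Y" "w \<in> Y" "x \<in> X" "norm (w - y) < d"
    then have "dist (G (w, x)) (G (y, x)) < \<omega>" by (intro d(2)) (auto simp: dist_Pair_Pair dist_norm)
    moreover have "dist (fst (G (w, x))) (fst (G (y, x))) \<le> dist (G (w, x)) (G (y, x))"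
      by (rule dist_fst_le)
    ultimately show "norm (fst (G (w, x)) - fst (G (y, x))) \<le> \<omega>" by (simp add: dist_norm)
  qed (rule d(1))
qed

lemma convex_on_section:
  fixes f :: "'a::real_vector \<times> 'b::real_vector \<Rightarrow> real"
  assumes f: "convex_on (Y \<times> X) f" and Y: "convex Y" and x: "x \<in> X"
  shows "convex_on Y (\<lambda>y. f (y, x))"
proof (rule convex_onI[OF _ Y])
  fix t :: real and y z assume "0 < t" "t < 1" "y \<in> Y" "z \<in> Y"
  then show "f ((1 - t) *\<^sub>R y + t *\<^sub>R z, x) \<le> (1 - t) * f (y, x) + t * f (z, x)"
    using convex_onD[OF f, of t "(y, x)" "(z, x)"] x by (simp flip: scaleR_left_distrib)
qed

section \<open>Convergence of the gap\<close>

theorem proposition4p6: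
  fixes Y :: "(real^'n) set" and X :: "(real^'m) set"
    and f :: "(real^'n) \<times> (real^'m) \<Rightarrow> real"
    and Gf :: "(real^'n) \<times> (real^'m) \<Rightarrow> (real^'n) \<times> (real^'m)"
    and g :: "(real^'n) \<times> (real^'m) \<Rightarrow> real^'p"
    and Gg :: "'p \<Rightarrow> (real^'n) \<times> (real^'m) \<Rightarrow> (real^'n) \<times> (real^'m)"
    and Q :: "nat \<Rightarrow> real^'n \<Rightarrow> real" and Qlow Qup :: "real^'n \<Rightarrow> real"
    and A :: "real^'n^'q" and B :: "real^'m^'q" and b :: "real^'q"
    and L \<epsilon> \<kappa> r :: real
    and xs :: "nat \<Rightarrow> real^'m" and eps :: "nat \<Rightarrow> real" and ys :: "nat \<Rightarrow> real^'n"
    and lam :: "nat \<Rightarrow> real^'q" and mu :: "nat \<Rightarrow> real^'p"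
  assumes Y: "Y \<noteq> {}" "compact Y" "convex Y"
    and X: "X \<noteq> {}" "compact X" "convex X"
    and f_C1: "C1_gradient_on (Y \<times> X) f Gf"
    and f_convex: "convex_on (Y \<times> X) f"
    and Q_convex: "\<And>k. k \<ge> 1 \<Longrightarrow> convex_on Y (Q k)"
    and Q_lipschitz: "\<And>k. k \<ge> 1 \<Longrightarrow> L-lipschitz_on Y (Q k)"
    and Q_bounds: "\<And>k y. k \<ge> 1 \<Longrightarrow> y \<in> Y \<Longrightarrow> Qlow y \<le> Q k y \<and> Q k y \<le> Qup y"
    and Q_bounds_cont: "continuous_on Y Qlow" "continuous_on Y Qup"
    and g_C1: "\<And>i. C1_gradient_on (Y \<times> X) (\<lambda>z. g z $ i) (Gg i)"
    and \<epsilon>_pos: "\<epsilon> > 0"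
    and g_convex: "\<And>i. convex_on (Y \<times> enlarge X \<epsilon>) (\<lambda>z. g z $ i)"
    and slater_consts: "\<kappa> > 0" "r > 0"
    and slater: "\<And>x. x \<in> X \<Longrightarrow> \<exists>y\<in>Y. cball y r \<inter> affine hull Y \<subseteq> Y \<and>
                   A *v y + B *v x = b \<and> (\<forall>i. g (y, x) $ i < - \<kappa>)"
    and xs: "\<And>k. k \<ge> 1 \<Longrightarrow> xs k \<in> X"
    and eps_nonneg: "\<And>k. k \<ge> 1 \<Longrightarrow> eps k \<ge> 0"
    and primal: "\<And>k. k \<ge> 1 \<Longrightarrow>
                   eps_opt_min (\<lambda>y. f (y, xs k) + Q k y)
                     (primal_feasible Y A B b g (xs k)) (eps k) (ys k)"
    and dual: "\<And>k. k \<ge> 1 \<Longrightarrow>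
                   eps_opt_max (dual_fun Y A B b g f (Q k) (xs k))
                     (dual_feasible Y A B b (xs k)) (eps k) (lam k, mu k)"
    and eps_lim: "eps \<longlonglongrightarrow> 0"
  shows "(\<lambda>k. eta Y A Gf Gg (Q k) (xs k) (ys k) (lam k) (mu k)) \<longlonglongrightarrow> 0"
proof -
  have yk: "ys k \<in> Y" if "k \<ge> 1" for k
    using primal[OF that] by (auto simp: eps_opt_min_def primal_feasible_def)
  have mu: "mu k $ i \<ge> 0" if "k \<ge> 1" for k i
    using dual[OF that] by (auto simp: eps_opt_max_def dual_feasible_def)
  have "continuous_on (Y \<times> X) (\<lambda>z. \<chi> i. g z $ i)"
    by (intro continuous_on_vec_lambda C1_gradient_on_continuous[OF g_C1])
  then have gcont: "continuous_on (Y \<times> X) g" by simp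
  have sec: "continuous_on Y (\<lambda>y. (y, x))" for x :: "real^'m" by (intro continuous_intros)
  have fcont: "continuous_on Y (\<lambda>y. f (y, xs k))" if "k \<ge> 1" for k
    by (rule continuous_on_compose2[OF C1_gradient_on_continuous[OF f_C1] sec]) (use xs[OF that] in auto)
  have gcont': "continuous_on Y (\<lambda>y. g (y, xs k))" if "k \<ge> 1" for k
    by (rule continuous_on_compose2[OF gcont sec]) (use xs[OF that] in auto)
  have "X \<subseteq> enlarge X \<epsilon>" unfolding enlarge_def by (force intro: exI[of _ 0])
  then have g_section: "convex_on Y (\<lambda>y. g (y, xs k) $ i)" if "k \<ge> 1" for k i
    using convex_on_section[OF g_convex Y(3)] xs[OF that] by blast

  define Lag where "Lag k w = f (w, xs k) + Q k w + lam k \<bullet> (A *v w + B *v xs k - b) + mu k \<bullet> g (w, xs k)" for k w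
  have key: "f (ys k, xs k) + Q k (ys k) \<le> Lag k w + 2 * eps k" if k: "k \<ge> 1" and w: "w \<in> Y" for k w
  proof -
    obtain y0 where y0: "y0 \<in> Y" "cball y0 r \<inter> affine hull Y \<subseteq> Y" "A *v y0 + B *v xs k = b"
      "\<forall>i. g (y0, xs k) $ i < - \<kappa>"
      using slater[OF xs[OF k]] by blast
    have "y0 \<in> rel_interior Y" using y0(1,2) slater_consts(2) by (auto simp: mem_rel_interior_cball)
    moreover have "g (y0, xs k) $ i < 0" for i using y0(4)[rule_format, of i] slater_consts(1) by linarith
    ultimately show ?thesis
      unfolding Lag_def
      by (intro lagrangian_eps_optimality[OF Y(2) _ _ _ gcont'[OF k] _ y0(3) _ primal[OF k] dual[OF k] w]
          convex_on_add convex_on_section[OF f_convex Y(3) xs[OF k]] Q_convex[OF k] g_section[OF k]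
          continuous_on_add fcont[OF k] lipschitz_on_continuous_on[OF Q_lipschitz[OF k]])
  qed

  obtain M where M: "\<And>k y. k \<ge> 1 \<Longrightarrow> y \<in> Y \<Longrightarrow> \<bar>f (y, xs k) + Q k y\<bar> \<le> M"
  proof -
    have "bounded (f ` (Y \<times> X))"
      using Y X C1_gradient_on_continuous[OF f_C1]
      by (intro compact_imp_bounded compact_continuous_image compact_Times)
    then obtain M1 where M1: "\<And>p. p \<in> Y \<times> X \<Longrightarrow> \<bar>f p\<bar> \<le> M1" by (force simp: bounded_iff)
    have "bounded (Qlow ` Y)" "bounded (Qup ` Y)"
      using Y Q_bounds_cont by (auto intro!: compact_imp_bounded compact_continuous_image)
    then obtain M2 M3 where M23: "\<And>y. y \<in> Y \<Longrightarrow> \<bar>Qlow y\<bar> \<le> M2" "\<And>y. y \<in> Y \<Longrightarrow> \<bar>Qup y\<bar> \<le> M3"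
      by (force simp: bounded_iff)
    show ?thesis
    proof (rule that[of "M1 + M2 + M3"])
      fix k :: nat and y assume "k \<ge> 1" "y \<in> Y"
      then show "\<bar>f (y, xs k) + Q k y\<bar> \<le> M1 + M2 + M3"
        using M1[of "(y, xs k)"] xs[of k] M23[of y] Q_bounds[of k y] by auto
    qed
  qed
  \<comment> \<open>From \<open>\<kappa> * (sum of the entries of \<mu>\<^sup>k) \<le> M + M + 2 * eps k\<close> at a Slater point.\<close>
  define K where "K = (2 * M + 2) / \<kappa>"
  have mu_bound: "(\<Sum>i\<in>UNIV. mu k $ i) \<le> K" if k: "k \<ge> 1" and e: "eps k \<le> 1" for k
  proof -
    obtain y0 where y0: "y0 \<in> Y" "A *v y0 + B *v xs k = b" "\<forall>i. g (y0, xs k) $ i < - \<kappa>"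
      using slater[OF xs[OF k]] by blast
    have "mu k \<bullet> g (y0, xs k) \<le> (\<Sum>i\<in>UNIV. mu k $ i * (- \<kappa>))"
      unfolding inner_vec_def inner_real_def using mu[OF k] y0(3)
      by (intro sum_mono mult_left_mono) (auto intro: less_imp_le)
    then have "mu k \<bullet> g (y0, xs k) \<le> - (\<kappa> * (\<Sum>i\<in>UNIV. mu k $ i))"
      by (simp add: sum_distrib_left sum_negf mult.commute)
    then have "\<kappa> * (\<Sum>i\<in>UNIV. mu k $ i) \<le> 2 * M + 2"
      using key[OF k y0(1)] M[OF k y0(1)] M[OF k yk[OF k]] e y0(2) by (simp add: Lag_def)
    then show ?thesis using slater_consts(1) by (simp add: K_def pos_le_divide_eq mult.commute)
  qed
  have K0: "K \<ge> 0" unfolding K_def using slater_consts(1) M[of 1 "ys 1"] yk[of 1] by auto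

  \<comment> \<open>The smooth part of the Lagrangian and its gradient.\<close>
  define S where "S k w = f (w, xs k) + lam k \<bullet> (A *v w + B *v xs k - b) + mu k \<bullet> g (w, xs k)" for k w
  define DS where "DS k w = fst (Gf (w, xs k)) + transpose A *v lam k
      + (\<Sum>i\<in>UNIV. mu k $ i *\<^sub>R fst (Gg i (w, xs k)))" for k w
  have S: "(S k has_derivative (\<lambda>h. DS k w \<bullet> h)) (at w within Y)" if k: "k \<ge> 1" and w: "w \<in> Y" for k w
  proof -
    have "((\<lambda>w. A *v w) has_derivative (\<lambda>h. A *v h)) (at w within Y)"
      by (intro linear_imp_has_derivative matrix_vector_mul_linear)
    then have "(S k has_derivative (\<lambda>h. fst (Gf (w, xs k)) \<bullet> h + lam k \<bullet> (A *v h + 0 - 0)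
        + (\<Sum>i\<in>UNIV. mu k $ i * (fst (Gg i (w, xs k)) \<bullet> h)))) (at w within Y)"
      unfolding S_def[abs_def] inner_vec_def[of "mu k"] inner_real_def
      by (intro has_derivative_add has_derivative_sum has_derivative_inner_right has_derivative_diff
          has_derivative_const has_derivative_mult_right
          C1_gradient_on_partial[OF f_C1] C1_gradient_on_partial[OF g_C1] xs k w)
    then show ?thesis
      by (simp add: DS_def inner_add_left inner_sum_left dot_lmul_matrix)
  qed
  have opt: "S k (ys k) + Q k (ys k) \<le> S k w + Q k w + 2 * eps k" if k: "k \<ge> 1" and w: "w \<in> Y" for k w
  proof -
    have feas: "A *v ys k + B *v xs k = b" "\<forall>i. g (ys k, xs k) $ i \<le> 0"
      using primal[OF k] by (auto simp: eps_opt_min_def primal_feasible_def)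
    have "mu k \<bullet> g (ys k, xs k) \<le> 0"
      unfolding inner_vec_def using mu[OF k] feas(2) by (intro sum_nonpos) (auto intro: mult_nonneg_nonpos)
    then show ?thesis using key[OF k w] feas(1) by (simp add: S_def Lag_def)
  qed
  obtain D where D: "\<And>y z. y \<in> Y \<Longrightarrow> z \<in> Y \<Longrightarrow> norm (z - y) \<le> D"
    using compact_imp_bounded[OF Y(2)] by (metis bounded_two_points dist_norm dist_commute)
  have D0: "D \<ge> 0" using D[of "ys 1" "ys 1"] yk[of 1] by simp

  have eta: "eta Y A Gf Gg (Q k) (xs k) (ys k) (lam k) (mu k)
      = (SUP y\<in>Y. DS k (ys k) \<bullet> (ys k - y) + Q k (ys k) - Q k y)" for k
    by (simp add: eta_def DS_def)
  show ?thesis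
  proof (rule LIMSEQ_I)
    fix e :: real assume e: "e > 0"
    \<comment> \<open>\<open>\<omega>\<close> is the variation allowed to each single gradient. Weighted by \<open>1 + K\<close> and over a
      distance at most \<open>D\<close>, it adds at most \<open>e / 4\<close> to the gap; the \<open>1 +\<close> in \<open>1 + D\<close> avoids division by \<open>0\<close>
      when \<open>Y\<close> is a point.\<close>
    define \<omega> where "\<omega> = e / (4 * (1 + K) * (1 + D))"
    have \<omega>: "\<omega> > 0" using e K0 D0 by (simp add: \<omega>_def)
    obtain d0 where d0: "d0 > 0" "\<forall>y\<in>Y. \<forall>w\<in>Y. \<forall>x\<in>X. norm (w - y) < d0 \<longrightarrow>
        norm (fst (Gf (w, x)) - fst (Gf (y, x))) \<le> \<omega>"
      using C1_gradient_on_partial_modulus[OF f_C1 Y(2) X(2) \<omega>] by blast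
    obtain dg where dg: "\<And>i. dg i > 0" "\<And>i. \<forall>y\<in>Y. \<forall>w\<in>Y. \<forall>x\<in>X. norm (w - y) < dg i \<longrightarrow>
        norm (fst (Gg i (w, x)) - fst (Gg i (y, x))) \<le> \<omega>"
      using C1_gradient_on_partial_modulus[OF g_C1 Y(2) X(2) \<omega>] by metis
    define d where "d = min d0 (Min (range dg))"
    have d: "d > 0" "d \<le> d0" "\<And>i. d \<le> dg i" using d0 dg(1) by (auto simp: d_def min.coboundedI2)
    \<comment> \<open>With this step length the whole step stays within distance \<open>d\<close> of its start; the
      choice does not depend on \<open>k\<close>, so \<open>eps k / t\<close> tends to \<open>0\<close>.\<close>
    define t where "t = min 1 (d / (2 * (1 + D)))"
    have t: "0 < t" "t \<le> 1" using d D0 by (auto simp: t_def)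
    have tD: "t * D < d"
    proof -
      have "t \<le> d / (2 * (1 + D))" by (simp add: t_def)
      then have "t * (2 * (1 + D)) \<le> d" using D0 by (subst (asm) pos_le_divide_eq) auto
      moreover have "0 \<le> t * D" using t D0 by simp
      ultimately show ?thesis using t by (simp add: algebra_simps)
    qed
    have "\<forall>\<^sub>F k in sequentially. dist (eps k) 0 < min 1 (e * t / 4)"
      using eps_lim e t by (intro tendstoD) auto
    then obtain N where N: "\<And>k. k \<ge> N \<Longrightarrow> \<bar>eps k\<bar> < min 1 (e * t / 4)"
      by (auto simp: eventually_sequentially)
    show "\<exists>N. \<forall>k\<ge>N. norm (eta Y A Gf Gg (Q k) (xs k) (ys k) (lam k) (mu k) - 0) < e"
    proof (intro exI allI impI)
      fix k assume kN: "k \<ge> max 1 N"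
      then have k: "k \<ge> 1" and ek: "eps k \<le> 1" "eps k < e * t / 4" using N[of k] by auto
      let ?phi = "\<lambda>y. DS k (ys k) \<bullet> (ys k - y) + Q k (ys k) - Q k y"
      have near: "norm (DS k w - DS k (ys k)) \<le> (1 + K) * \<omega>" if w: "w \<in> Y" "norm (w - ys k) < d" for w
      proof -
        have "DS k w - DS k (ys k) = (fst (Gf (w, xs k)) - fst (Gf (ys k, xs k)))
            + (\<Sum>i\<in>UNIV. mu k $ i *\<^sub>R (fst (Gg i (w, xs k)) - fst (Gg i (ys k, xs k))))"
          by (simp add: DS_def sum_subtractf scaleR_diff_right)
        also have "norm \<dots> \<le> \<omega> + (\<Sum>i\<in>UNIV. mu k $ i * \<omega>)"
        proof (intro norm_triangle_le add_mono norm_sum[THEN order_trans] sum_mono)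
          show "norm (fst (Gf (w, xs k)) - fst (Gf (ys k, xs k))) \<le> \<omega>"
            using d0(2) w yk[OF k] xs[OF k] d(2) by auto
          fix i
          have "norm (fst (Gg i (w, xs k)) - fst (Gg i (ys k, xs k))) \<le> \<omega>"
            using dg(2)[of i] w yk[OF k] xs[OF k] d(3)[of i] by auto
          then show "norm (mu k $ i *\<^sub>R (fst (Gg i (w, xs k)) - fst (Gg i (ys k, xs k)))) \<le> mu k $ i * \<omega>"
            using mu[OF k, of i] by (simp add: mult_left_mono)
        qed
        also have "\<dots> = (1 + (\<Sum>i\<in>UNIV. mu k $ i)) * \<omega>" by (simp add: distrib_right flip: sum_distrib_right)
        also have "\<dots> \<le> (1 + K) * \<omega>" using mu_bound[OF k ek(1)] \<omega> by (intro mult_right_mono) auto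
        finally show ?thesis .
      qed
      have le: "?phi y \<le> 3 * e / 4" if y: "y \<in> Y" for y
      proof -
        have "?phi y \<le> 2 * eps k / t + (1 + K) * \<omega> * norm (y - ys k)"
        proof (rule linearised_gap_le[OF Q_convex[OF k] S[OF k] yk[OF k] y t opt[OF k]])
          fix w assume w: "w \<in> Y" "norm (w - ys k) \<le> t * norm (y - ys k)"
          have "t * norm (y - ys k) \<le> t * D" using t D[OF yk[OF k] y] by (intro mult_left_mono) auto
          then show "norm (DS k w - DS k (ys k)) \<le> (1 + K) * \<omega>" using near w tD by simp
        qed
        also have "2 * eps k / t \<le> e / 2" using ek(2) t by (simp add: field_simps)
        also have "(1 + K) * \<omega> * norm (y - ys k) \<le> (1 + K) * \<omega> * (1 + D)"
          using K0 \<omega> D[OF yk[OF k] y] by (intro mult_left_mono) auto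
        also have "\<dots> = e / 4"
        proof -
          have "4 * (1 + K) * (1 + D) \<noteq> 0" using K0 D0 by (simp add: add_nonneg_eq_0_iff)
          then have "\<omega> * (4 * (1 + K) * (1 + D)) = e"
            unfolding \<omega>_def by (rule nonzero_eq_divide_eq[THEN iffD1, OF _ refl])
          then show ?thesis by (simp add: algebra_simps)
        qed
        finally show ?thesis by simp
      qed
      have "(SUP y\<in>Y. ?phi y) \<le> 3 * e / 4" using Y(1) le by (rule cSUP_least)
      moreover have "?phi (ys k) \<le> (SUP y\<in>Y. ?phi y)"
        using le by (intro cSUP_upper yk[OF k] bdd_aboveI2)
      ultimately show "norm (eta Y A Gf Gg (Q k) (xs k) (ys k) (lam k) (mu k) - 0) < e"
        unfolding eta using e by simp
    qed
  qed
qed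

end
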